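(* Let $S,T\in\mathfrak S$ be nonempty. (a) $S\sim(S\wedge T)U$ and $T\sim(S\wedge T)V$, where $U,V$ are (+)-admissible sequences on $(\Gamma,\Lambda^{S\wedge T})$ that are unique up to equivalence. (b) $\mathrm{Supp}\,U\cap\mathrm{Supp}\,V=\emptyset$. (c) $UV$ and $VU$ are (+)-admissible sequences on $(\Gamma,\Lambda^{S\wedge T})$ and $UV\sim VU$. (d) $S\vee T\sim(S\wedge T)UV\sim SV\sim TU$.
   Context: $\Gamma=(\Gamma_0,\Gamma_1)$ is a finite connected graph (multiple edges allowed) without loops and with more than one vertex. An orientation $\Lambda$ on $\Gamma$ chooses for each edge a starting point and an endpoint among its incident vertices, giving a quiver $(\Gamma,\Lambda)$; all orientations are assumed to have no oriented cycles. A sink is a vertex at which no arrow starts. $\sigma_x\Lambda$ is the orientation obtained by reversing all arrows incident with $x$. A finite sequence $S=x_1,\dots,x_s$ of vertices ($s\ge 0$) is (+)-admissible on $(\Gamma,\Lambda)$ if $x_1$ is a sink for $\Lambda$, $x_2$ is a sink for $\sigma_{x_1}\Lambda$, and so on; put $\Lambda^S=\sigma_{x_s}\cdots\sigma_{x_1}\Lambda$. $\mathfrak S$ is the set of (+)-admissible sequences on $(\Gamma,\Lambda)$. Juxtaposition $UV$ denotes concatenation. $\sim$ is the equivalence relation on (+)-admissible sequences on a given quiver generated by interchanging two consecutive terms $x_i,x_{i+1}$ that are not connected by an edge of $\Gamma$. $\mathrm{Supp}\,S$ is the set of vertices occurring in $S$. Canonical form: every nonempty $S\in\mathfrak S$ satisfies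 $S\sim S_1\cdots S_r$ where each segment $S_i$ is nonempty, consists of distinct vertices, and $\mathrm{Supp}\,S_i=\mathrm{Supp}\,S_iS_{i+1}\cdots S_r$; $r$ and the segments up to equivalence are determined by $S$, and $S$ is determined up to $\sim$ by the sets $\mathrm{Supp}\,S_1,\dots,\mathrm{Supp}\,S_r$. Meet and join (defined up to $\sim$): let $S,T$ be nonempty with canonical forms $S_1\cdots S_r$, $T_1\cdots T_q$, $r\le q$. $S\wedge T$ is the sequence in $\mathfrak S$ with canonical form $R_1\cdots R_r$ (empty segments being omitted) where $\mathrm{Supp}\,R_i=\mathrm{Supp}\,S_i\cap\mathrm{Supp}\,T_i$ for $0<i\le r$. $S\vee T$ is the sequence in $\mathfrak S$ with canonical form $R_1\cdots R_q$ where $\mathrm{Supp}\,R_i=\mathrm{Supp}\,S_i\cup\mathrm{Supp}\,T_i$ for $0<i\le r$ and $\mathrm{Supp}\,R_i=\mathrm{Supp}\,T_i$ for $r<i\le q$. Such sequences exist in $\mathfrak S$. *)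

theory Defs
  imports Main
begin

record ('v, 'e) multigraph =
  verts :: "'v set"
  edges :: "'e set"
  ends :: "'e \<Rightarrow> 'v set"

definition adjacent :: "('v, 'e) multigraph \<Rightarrow> 'v \<Rightarrow> 'v \<Rightarrow> bool" where
  "adjacent \<Gamma> x y \<longleftrightarrow> (\<exists>e\<in>edges \<Gamma>. ends \<Gamma> e = {x, y})"

text \<open>The standing assumptions on the graph. Multiple edges are allowed since distinct edges
  may have the same set of ends; loops are excluded because every edge has exactly two ends.\<close>

locale connected_multigraph =
  fixes \<Gamma> :: "('v, 'e) multigraph"
  assumes finite_verts: "finite (verts \<Gamma>)"
    and finite_edges: "finite (edges \<Gamma>)"
    and ends_in_verts: "e \<in> edges \<Gamma> \<Longrightarrow> ends \<Gamma> e \<subseteq> verts \<Gamma>"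
    and two_ends: "e \<in> edges \<Gamma> \<Longrightarrow> card (ends \<Gamma> e) = 2"
    and connected: "x \<in> verts \<Gamma> \<Longrightarrow> y \<in> verts \<Gamma> \<Longrightarrow> (adjacent \<Gamma>)\<^sup>*\<^sup>* x y"
    and more_than_one_vertex: "card (verts \<Gamma>) > 1"

text \<open>An orientation sends each edge to the pair (starting point, endpoint). Its values
  outside \<^term>\<open>edges \<Gamma>\<close> are irrelevant.\<close>

type_synonym ('v, 'e) orientation = "'e \<Rightarrow> 'v \<times> 'v"

definition is_orientation :: "('v, 'e) multigraph \<Rightarrow> ('v, 'e) orientation \<Rightarrow> bool" where
  "is_orientation \<Gamma> \<Lambda> \<longleftrightarrow> (\<forall>e\<in>edges \<Gamma>. ends \<Gamma> e = {fst (\<Lambda> e), snd (\<Lambda> e)})"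

definition no_oriented_cycles :: "('v, 'e) multigraph \<Rightarrow> ('v, 'e) orientation \<Rightarrow> bool" where
  "no_oriented_cycles \<Gamma> \<Lambda> \<longleftrightarrow> acyclic (\<Lambda> ` edges \<Gamma>)"

definition sink :: "('v, 'e) multigraph \<Rightarrow> ('v, 'e) orientation \<Rightarrow> 'v \<Rightarrow> bool" where
  "sink \<Gamma> \<Lambda> x \<longleftrightarrow> x \<in> verts \<Gamma> \<and> (\<forall>e\<in>edges \<Gamma>. fst (\<Lambda> e) \<noteq> x)"

definition reflect ::
    "('v, 'e) multigraph \<Rightarrow> 'v \<Rightarrow> ('v, 'e) orientation \<Rightarrow> ('v, 'e) orientation" where
  "reflect \<Gamma> x \<Lambda> =
     (\<lambda>e. if e \<in> edges \<Gamma> \<and> x \<in> ends \<Gamma> e then prod.swap (\<Lambda> e) else \<Lambda> e)"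

text \<open>The orientation $\Lambda^S$; the first vertex of the sequence is reflected first.\<close>

definition reflect_seq ::
    "('v, 'e) multigraph \<Rightarrow> 'v list \<Rightarrow> ('v, 'e) orientation \<Rightarrow> ('v, 'e) orientation" where
  "reflect_seq \<Gamma> S \<Lambda> = fold (reflect \<Gamma>) S \<Lambda>"

fun admissible :: "('v, 'e) multigraph \<Rightarrow> ('v, 'e) orientation \<Rightarrow> 'v list \<Rightarrow> bool" where
  "admissible \<Gamma> \<Lambda> [] \<longleftrightarrow> True"
| "admissible \<Gamma> \<Lambda> (x # S) \<longleftrightarrow> sink \<Gamma> \<Lambda> x \<and> admissible \<Gamma> (reflect \<Gamma> x \<Lambda>) S"

definition interchange ::
    "('v, 'e) multigraph \<Rightarrow> ('v, 'e) orientation \<Rightarrow> 'v list \<Rightarrow> 'v list \<Rightarrow> bool" where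
  "interchange \<Gamma> \<Lambda> S T \<longleftrightarrow> admissible \<Gamma> \<Lambda> S \<and> admissible \<Gamma> \<Lambda> T \<and>
     (\<exists>A x y B. S = A @ [x, y] @ B \<and> T = A @ [y, x] @ B \<and> \<not> adjacent \<Gamma> x y)"

text \<open>This is an equivalence relation on the set of admissible sequences only: in particular
  equivalent sequences are admissible.\<close>

definition seq_equiv ::
    "('v, 'e) multigraph \<Rightarrow> ('v, 'e) orientation \<Rightarrow> 'v list \<Rightarrow> 'v list \<Rightarrow> bool" where
  "seq_equiv \<Gamma> \<Lambda> S T \<longleftrightarrow>
     admissible \<Gamma> \<Lambda> S \<and> admissible \<Gamma> \<Lambda> T \<and> equivclp (interchange \<Gamma> \<Lambda>) S T"

text \<open>The canonical form is given by its list of segments. The empty sequence has the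
  canonical form with no segments; this is needed when all segments of a meet are omitted.\<close>

definition canonical_form ::
    "('v, 'e) multigraph \<Rightarrow> ('v, 'e) orientation \<Rightarrow> 'v list \<Rightarrow> 'v list list \<Rightarrow> bool" where
  "canonical_form \<Gamma> \<Lambda> S Ss \<longleftrightarrow> seq_equiv \<Gamma> \<Lambda> S (concat Ss) \<and>
     (\<forall>i<length Ss. Ss ! i \<noteq> [] \<and> distinct (Ss ! i) \<and> set (Ss ! i) = set (concat (drop i Ss)))"

definition is_meet ::
    "('v, 'e) multigraph \<Rightarrow> ('v, 'e) orientation \<Rightarrow> 'v list \<Rightarrow> 'v list \<Rightarrow> 'v list \<Rightarrow> bool" where
  "is_meet \<Gamma> \<Lambda> S T M \<longleftrightarrow>
     (\<exists>Ss Ts Rs. canonical_form \<Gamma> \<Lambda> S Ss \<and> canonical_form \<Gamma> \<Lambda> T Ts \<and>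
        length Rs = min (length Ss) (length Ts) \<and>
        (\<forall>i<length Rs. set (Rs ! i) = set (Ss ! i) \<inter> set (Ts ! i)) \<and>
        canonical_form \<Gamma> \<Lambda> M (filter (\<lambda>R. R \<noteq> []) Rs))"

text \<open>The support of the i-th segment, counted from 0, and the empty set beyond the last one.
  Thus joins need no assumption on which of the two canonical forms is longer.\<close>

definition segment_supp :: "'v list list \<Rightarrow> nat \<Rightarrow> 'v set" where
  "segment_supp Ss i = (if i < length Ss then set (Ss ! i) else {})"

definition is_join ::
    "('v, 'e) multigraph \<Rightarrow> ('v, 'e) orientation \<Rightarrow> 'v list \<Rightarrow> 'v list \<Rightarrow> 'v list \<Rightarrow> bool" where
  "is_join \<Gamma> \<Lambda> S T J \<longleftrightarrow>
     (\<exists>Ss Ts Rs. canonical_form \<Gamma> \<Lambda> S Ss \<and> canonical_form \<Gamma> \<Lambda> T Ts \<and>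
        length Rs = max (length Ss) (length Ts) \<and>
        (\<forall>i<length Rs. set (Rs ! i) = segment_supp Ss i \<union> segment_supp Ts i) \<and>
        canonical_form \<Gamma> \<Lambda> J Rs)"

text \<open>Meet and join are only defined up to equivalence; the functions below choose arbitrary
  representatives.\<close>

definition seq_meet ::
    "('v, 'e) multigraph \<Rightarrow> ('v, 'e) orientation \<Rightarrow> 'v list \<Rightarrow> 'v list \<Rightarrow> 'v list" where
  "seq_meet \<Gamma> \<Lambda> S T = (SOME M. is_meet \<Gamma> \<Lambda> S T M)"

definition seq_join ::
    "('v, 'e) multigraph \<Rightarrow> ('v, 'e) orientation \<Rightarrow> 'v list \<Rightarrow> 'v list \<Rightarrow> 'v list" where
  "seq_join \<Gamma> \<Lambda> S T = (SOME J. is_join \<Gamma> \<Lambda> S T J)"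

end

theory Submission
  imports Defs "HOL-Library.Multiset"
begin

text \<open>
  Everything is controlled by the multiset of vertices of a sequence. An admissible sequence
  reflects at the two ends of an edge alternately, beginning with the endpoint of the arrow.
  So the multiplicities \<open>f\<close> satisfy \<open>f a \<le> f b \<le> f a + 1\<close> for every arrow from \<open>a\<close> to \<open>b\<close>;
  multisets with this property are called feasible. Three facts reduce sequences to multisets.

  \<^item> Two admissible sequences are equivalent if and only if they have the same multiplicities
    (\<open>seq_equiv_iff\<close>): the first vertex of one can be moved to the front of the other.
  \<^item> If there are no oriented cycles, an admissible sequence extends to any feasible multiset that
    contains its own (\<open>feasible_extension\<close>).
  \<^item> The segments of a canonical form are the level sets of the multiplicities
    (\<open>canonical_form_segment_supp\<close>).

  By the last fact the meet of two sequences has as multiplicities the minimum and the join has the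
  maximum; the first two show that both exist, as feasible multisets are closed under minima
  and maxima. Now let \<open>f\<close> and \<open>g\<close> be the multiplicities of \<open>S\<close> and \<open>T\<close>. Extending the meet
  to \<open>f\<close> and to \<open>g\<close> yields \<open>U\<close> and \<open>V\<close>, with multiplicities \<open>f - min f g\<close> and \<open>g - min f g\<close>,
  which explains uniqueness and disjointness of the supports. The sequences \<open>U\<close> and \<open>V\<close> can
  follow the meet in either order because the prefixes that end in the second of them have as
  multiplicities a maximum of two feasible multisets
  (\<open>admissible_disjoint_extensions\<close>). Finally
  \<open>min f g + (f - min f g) + (g - min f g) = max f g\<close>, so all sequences that are claimed to be
  equivalent have equal multiplicities.
\<close>

section \<open>Reflections\<close>

lemma reflect_seq_simps [simp]:
  "reflect_seq \<Gamma> [] \<Lambda> = \<Lambda>"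
  "reflect_seq \<Gamma> (x # S) \<Lambda> = reflect_seq \<Gamma> S (reflect \<Gamma> x \<Lambda>)"
  "reflect_seq \<Gamma> (S @ T) \<Lambda> = reflect_seq \<Gamma> T (reflect_seq \<Gamma> S \<Lambda>)"
  by (simp_all add: reflect_seq_def)

lemma reflect_commute: "reflect \<Gamma> x (reflect \<Gamma> y \<Lambda>) = reflect \<Gamma> y (reflect \<Gamma> x \<Lambda>)"
  by (auto simp: reflect_def fun_eq_iff)

lemma reflect_seq_mset_cong:
  assumes "mset S = mset T"
  shows "reflect_seq \<Gamma> S \<Lambda> = reflect_seq \<Gamma> T \<Lambda>"
proof -
  have "fold (reflect \<Gamma>) S = fold (reflect \<Gamma>) T"
    by (rule fold_multiset_equiv[OF _ assms]) (simp add: fun_eq_iff reflect_commute)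
  then show ?thesis by (simp add: reflect_seq_def)
qed

lemma admissible_append:
  "admissible \<Gamma> \<Lambda> (S @ T) \<longleftrightarrow> admissible \<Gamma> \<Lambda> S \<and> admissible \<Gamma> (reflect_seq \<Gamma> S \<Lambda>) T"
  by (induction S arbitrary: \<Lambda>) auto

lemma admissible_imp_verts: "admissible \<Gamma> \<Lambda> S \<Longrightarrow> set S \<subseteq> verts \<Gamma>"
  by (induction S arbitrary: \<Lambda>) (auto simp: sink_def)

lemma is_orientation_reflect: "is_orientation \<Gamma> \<Lambda> \<Longrightarrow> is_orientation \<Gamma> (reflect \<Gamma> x \<Lambda>)"
  by (auto simp: is_orientation_def reflect_def)

lemma is_orientation_reflect_seq:
  "is_orientation \<Gamma> \<Lambda> \<Longrightarrow> is_orientation \<Gamma> (reflect_seq \<Gamma> S \<Lambda>)"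
  by (induction S arbitrary: \<Lambda>) (auto simp: is_orientation_reflect)

locale quiver = connected_multigraph \<Gamma>
  for \<Gamma> :: "('v, 'e) multigraph" +
  fixes \<Lambda> :: "('v, 'e) orientation"
  assumes orientation: "is_orientation \<Gamma> \<Lambda>"
begin

lemma quiver_reflect_seq: "quiver \<Gamma> (reflect_seq \<Gamma> S \<Lambda>)"
  using is_orientation_reflect_seq[OF orientation] by unfold_locales

lemma ends_arrow: "e \<in> edges \<Gamma> \<Longrightarrow> ends \<Gamma> e = {fst (\<Lambda> e), snd (\<Lambda> e)}"
  using orientation by (simp add: is_orientation_def)

lemma arrow_no_loop: "e \<in> edges \<Gamma> \<Longrightarrow> fst (\<Lambda> e) \<noteq> snd (\<Lambda> e)"
  using two_ends[of e] ends_arrow[of e] by auto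

lemma arrow_in_verts: "e \<in> edges \<Gamma> \<Longrightarrow> fst (\<Lambda> e) \<in> verts \<Gamma> \<and> snd (\<Lambda> e) \<in> verts \<Gamma>"
  using ends_in_verts[of e] ends_arrow[of e] by auto

section \<open>The multiplicities of admissible sequences\<close>

text \<open>The multisets of vertices in admissible sequences are characterised by one condition for
  each arrow. Between two reflections at one end of an edge there is exactly one reflection at
  the other end, because a reflection at a sink turns all of its arrows outwards; and the first
  reflection is at the endpoint of the arrow. So the endpoint always is level with the starting
  point, or ahead by one.\<close>

definition feasible :: "'v multiset \<Rightarrow> bool" where
  "feasible G \<longleftrightarrow> set_mset G \<subseteq> verts \<Gamma> \<and>
     (\<forall>e\<in>edges \<Gamma>. count G (fst (\<Lambda> e)) \<le> count G (snd (\<Lambda> e)) \<and>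
                 count G (snd (\<Lambda> e)) \<le> Suc (count G (fst (\<Lambda> e))))"

lemma feasibleD:
  assumes "feasible G" "e \<in> edges \<Gamma>"
  shows "count G (fst (\<Lambda> e)) \<le> count G (snd (\<Lambda> e))"
    and "count G (snd (\<Lambda> e)) \<le> Suc (count G (fst (\<Lambda> e)))"
  using assms by (auto simp: feasible_def)

text \<open>Minima and maxima are monotone and commute with adding one to both arguments, so they
  respect both inequalities.\<close>

lemma feasible_inter: "feasible F \<Longrightarrow> feasible G \<Longrightarrow> feasible (F \<inter># G)"
  by (fastforce simp: feasible_def min_def)

lemma feasible_union: "feasible F \<Longrightarrow> feasible G \<Longrightarrow> feasible (F \<union># G)"
  by (fastforce simp: feasible_def max_def)

lemma feasible_constant: "feasible (repeat_mset n (mset_set (verts \<Gamma>)))"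
  by (auto simp: feasible_def finite_verts arrow_in_verts count_mset_set'
      simp flip: count_greater_zero_iff split: if_splits)

text \<open>The orientation of an edge after \<^term>\<open>S\<close> can be read off from the multiplicities of its ends
  in \<^term>\<open>S\<close>, since each reflection at one of the ends must happen at the current endpoint.\<close>

lemma arrow_state:
  assumes "e \<in> edges \<Gamma>" and "admissible \<Gamma> \<Lambda> S"
  defines "a \<equiv> count (mset S) (fst (\<Lambda> e))" and "b \<equiv> count (mset S) (snd (\<Lambda> e))"
  shows "(b = a \<and> reflect_seq \<Gamma> S \<Lambda> e = \<Lambda> e) \<or>
         (b = Suc a \<and> reflect_seq \<Gamma> S \<Lambda> e = prod.swap (\<Lambda> e))"
  using assms(2) unfolding a_def b_def
proof (induction S rule: rev_induct)
  case Nil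
  then show ?case by simp
next
  case (snoc x S)
  have S: "admissible \<Gamma> \<Lambda> S" and x: "sink \<Gamma> (reflect_seq \<Gamma> S \<Lambda>) x"
    using snoc.prems by (auto simp: admissible_append)
  have "fst (reflect_seq \<Gamma> S \<Lambda> e) \<noteq> x"
    using x assms(1) by (auto simp: sink_def)
  then show ?case
    using snoc.IH[OF S] arrow_no_loop[OF assms(1)] assms(1) ends_arrow[OF assms(1)]
    by (auto simp: reflect_def)
qed

lemma admissible_imp_feasible: "admissible \<Gamma> \<Lambda> S \<Longrightarrow> feasible (mset S)"
  using admissible_imp_verts[of \<Gamma> \<Lambda> S] arrow_state[of _ S] by (fastforce simp: feasible_def)

text \<open>Feasibility detects sinks: if a further reflection at \<^term>\<open>x\<close> keeps all arrow inequalities,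
  then by the preceding description of the state no edge starts at \<^term>\<open>x\<close>. Hence a sequence is
  admissible exactly when all of its prefixes are feasible.\<close>

lemma admissible_snoc_iff:
  "admissible \<Gamma> \<Lambda> (S @ [x]) \<longleftrightarrow> admissible \<Gamma> \<Lambda> S \<and> feasible (add_mset x (mset S))"
proof (intro iffI conjI)
  assume A: "admissible \<Gamma> \<Lambda> (S @ [x])"
  then show "admissible \<Gamma> \<Lambda> S" by (simp add: admissible_append)
  show "feasible (add_mset x (mset S))"
    using admissible_imp_feasible[OF A] by simp
next
  assume A: "admissible \<Gamma> \<Lambda> S \<and> feasible (add_mset x (mset S))"
  have "fst (reflect_seq \<Gamma> S \<Lambda> e) \<noteq> x" if e: "e \<in> edges \<Gamma>" for e
    using arrow_state[OF e, of S] A arrow_no_loop[OF e]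
      feasibleD[OF conjunct2[OF A] e] by (auto split: if_splits)
  then show "admissible \<Gamma> \<Lambda> (S @ [x])"
    using A by (auto simp: admissible_append sink_def feasible_def)
qed

lemma admissible_prefix_cong:
  assumes "admissible \<Gamma> \<Lambda> S" "mset S = mset S'" "admissible \<Gamma> \<Lambda> (S' @ V)"
  shows "admissible \<Gamma> \<Lambda> (S @ V)"
  using assms(1,3) unfolding admissible_append reflect_seq_mset_cong[OF assms(2)] by blast

text \<open>Let \<open>V'\<close> be a prefix of \<^term>\<open>V\<close>. At every vertex \<^term>\<open>U\<close> or \<open>V'\<close> adds nothing, so
  the multiplicities of \<open>M @ U @ V'\<close> are the maximum of those of \<open>M @ U\<close> and \<open>M @ V'\<close>. Both are
  feasible, and so is their maximum.\<close>

lemma admissible_disjoint_extensions: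
  assumes U: "admissible \<Gamma> \<Lambda> (M @ U)" and V: "admissible \<Gamma> \<Lambda> (M @ V)"
    and disj: "set U \<inter> set V = {}"
  shows "admissible \<Gamma> \<Lambda> (M @ U @ V)"
  using V disj
proof (induction V rule: rev_induct)
  case Nil
  then show ?case using U by simp
next
  case (snoc x V)
  have V: "admissible \<Gamma> \<Lambda> (M @ V)"
    using snoc.prems(1) admissible_snoc_iff[of "M @ V" x] by simp
  then have UV: "admissible \<Gamma> \<Lambda> (M @ U @ V)"
    using snoc.IH snoc.prems(2) by simp
  have "add_mset x (mset (M @ U @ V)) = mset (M @ U) \<union># mset (M @ V @ [x])"
  proof (rule multiset_eqI)
    fix y
    consider "count (mset U) y = 0" | "count (mset V) y = 0" "y \<noteq> x"
      using snoc.prems(2) unfolding count_mset_0_iff by auto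
    then show "count (add_mset x (mset (M @ U @ V))) y =
        count (mset (M @ U) \<union># mset (M @ V @ [x])) y"
      by cases (simp_all del: count_mset_0_iff)
  qed
  then have "feasible (add_mset x (mset (M @ U @ V)))"
    using feasible_union admissible_imp_feasible U snoc.prems(1) by metis
  then show ?case
    using UV admissible_snoc_iff[of "M @ U @ V" x] by simp
qed

end

section \<open>Equivalence is equality of multiplicities\<close>

lemma seq_equiv_refl: "admissible \<Gamma> \<Lambda> S \<Longrightarrow> seq_equiv \<Gamma> \<Lambda> S S"
  by (simp add: seq_equiv_def)

lemma seq_equiv_trans: "seq_equiv \<Gamma> \<Lambda> R S \<Longrightarrow> seq_equiv \<Gamma> \<Lambda> S T \<Longrightarrow> seq_equiv \<Gamma> \<Lambda> R T"
  by (auto simp: seq_equiv_def intro: equivclp_trans)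

lemma seq_equiv_sym: "seq_equiv \<Gamma> \<Lambda> S T \<Longrightarrow> seq_equiv \<Gamma> \<Lambda> T S"
  by (auto simp: seq_equiv_def intro: equivclp_sym)

lemma interchange_imp_mset_eq: "interchange \<Gamma> \<Lambda> S T \<Longrightarrow> mset S = mset T"
  by (auto simp: interchange_def)

lemma seq_equiv_imp_mset_eq:
  assumes "seq_equiv \<Gamma> \<Lambda> S T"
  shows "mset S = mset T"
proof -
  have "equivclp (interchange \<Gamma> \<Lambda>) S T" using assms by (simp add: seq_equiv_def)
  then show ?thesis
    by (induction rule: equivclp_induct) (auto dest: interchange_imp_mset_eq)
qed

lemma interchange_Cons:
  assumes "sink \<Gamma> \<Lambda> x" "interchange \<Gamma> (reflect \<Gamma> x \<Lambda>) S T"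
  shows "interchange \<Gamma> \<Lambda> (x # S) (x # T)"
proof -
  obtain A y z B where "S = A @ [y, z] @ B" "T = A @ [z, y] @ B" "\<not> adjacent \<Gamma> y z"
    using assms(2) by (auto simp: interchange_def)
  then have "x # S = (x # A) @ [y, z] @ B \<and> x # T = (x # A) @ [z, y] @ B \<and> \<not> adjacent \<Gamma> y z"
    by simp
  then show ?thesis
    using assms unfolding interchange_def admissible.simps by blast
qed

lemma seq_equiv_Cons:
  assumes x: "sink \<Gamma> \<Lambda> x" and ST: "seq_equiv \<Gamma> (reflect \<Gamma> x \<Lambda>) S T"
  shows "seq_equiv \<Gamma> \<Lambda> (x # S) (x # T)"
proof -
  have "equivclp (interchange \<Gamma> (reflect \<Gamma> x \<Lambda>)) S T" using ST by (simp add: seq_equiv_def)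
  then have "equivclp (interchange \<Gamma> \<Lambda>) (x # S) (x # T)"
    by (induction rule: equivclp_induct)
      (auto intro: interchange_Cons[OF x] equivclp_trans r_into_equivclp converse_r_into_equivclp)
  then show ?thesis using assms by (simp add: seq_equiv_def)
qed

lemma adjacent_sym: "adjacent \<Gamma> x y \<longleftrightarrow> adjacent \<Gamma> y x"
  by (simp add: adjacent_def insert_commute)

lemma (in connected_multigraph) sink_reflect_iff:
  assumes "is_orientation \<Gamma> \<Lambda>" and "\<not> adjacent \<Gamma> x y" and "x \<noteq> y"
  shows "sink \<Gamma> (reflect \<Gamma> y \<Lambda>) x \<longleftrightarrow> sink \<Gamma> \<Lambda> x"
proof -
  have "fst (reflect \<Gamma> y \<Lambda> e) = x \<longleftrightarrow> fst (\<Lambda> e) = x" if "e \<in> edges \<Gamma>" for e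
    using assms that by (fastforce simp: reflect_def adjacent_def is_orientation_def)
  then show ?thesis by (simp add: sink_def)
qed

text \<open>A sink that is not adjacent to any of the vertices before it is still a sink after each of
  them has been reflected. So it can be moved to the front by interchanges all of whose
  intermediate sequences are admissible.\<close>

lemma (in connected_multigraph) move_sink_to_front:
  assumes "is_orientation \<Gamma> \<Lambda>" and "admissible \<Gamma> \<Lambda> (A @ x # B)" and "sink \<Gamma> \<Lambda> x"
    and "x \<notin> set A" and "\<forall>y\<in>set A. \<not> adjacent \<Gamma> x y"
  shows "seq_equiv \<Gamma> \<Lambda> (A @ x # B) (x # A @ B)"
  using assms
proof (induction A arbitrary: \<Lambda>)
  case Nil
  then show ?case by (simp add: seq_equiv_refl)
next
  case (Cons y A)
  have xy: "\<not> adjacent \<Gamma> x y" "x \<noteq> y" and y: "sink \<Gamma> \<Lambda> y" using Cons.prems by auto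
  have "seq_equiv \<Gamma> (reflect \<Gamma> y \<Lambda>) (A @ x # B) (x # A @ B)"
    using Cons.prems xy
    by (intro Cons.IH) (auto simp: is_orientation_reflect sink_reflect_iff)
  then have 1: "seq_equiv \<Gamma> \<Lambda> (y # A @ x # B) (y # x # A @ B)"
    by (rule seq_equiv_Cons[OF y])
  then have adm: "admissible \<Gamma> \<Lambda> (y # x # A @ B)" by (simp add: seq_equiv_def)
  have "sink \<Gamma> (reflect \<Gamma> x \<Lambda>) y"
    using y xy sink_reflect_iff[of \<Lambda> y x] Cons.prems(1) by (simp add: adjacent_sym)
  then have "admissible \<Gamma> \<Lambda> (x # y # A @ B)"
    using adm Cons.prems(3) by (simp add: reflect_commute)
  moreover have "y # x # A @ B = [] @ [y, x] @ (A @ B) \<and> x # y # A @ B = [] @ [x, y] @ (A @ B)"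
    by simp
  ultimately have "interchange \<Gamma> \<Lambda> (y # x # A @ B) (x # y # A @ B)"
    using adm xy unfolding interchange_def by (metis adjacent_sym)
  then have "seq_equiv \<Gamma> \<Lambda> (y # x # A @ B) (x # y # A @ B)"
    unfolding seq_equiv_def using interchange_def r_into_equivclp by metis
  with 1 show ?case by (auto intro: seq_equiv_trans)
qed

text \<open>Induction on the first sequence \<^term>\<open>x # S\<close>. As \<^term>\<open>x\<close> is a sink, a neighbour of \<^term>\<open>x\<close>
  cannot be reflected before \<^term>\<open>x\<close> is. So in the second sequence the first \<^term>\<open>x\<close> comes before
  all of its neighbours and can be moved to the front, where it is cancelled.\<close>

lemma (in connected_multigraph) mset_eq_imp_seq_equiv:
  assumes "is_orientation \<Gamma> \<Lambda>" and "admissible \<Gamma> \<Lambda> S" and "admissible \<Gamma> \<Lambda> T"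
    and "mset S = mset T"
  shows "seq_equiv \<Gamma> \<Lambda> S T"
  using assms
proof (induction S arbitrary: \<Lambda> T)
  case Nil
  then show ?case by (simp add: seq_equiv_refl)
next
  case (Cons x S)
  interpret quiver \<Gamma> \<Lambda> using Cons.prems(1) by unfold_locales
  have x: "sink \<Gamma> \<Lambda> x" and S: "admissible \<Gamma> (reflect \<Gamma> x \<Lambda>) S" using Cons.prems by auto
  have "x \<in> set T" using Cons.prems(4) by (metis list.set_intros(1) set_mset_mset)
  then obtain A B where T: "T = A @ x # B" and A: "x \<notin> set A" by (meson split_list_first)
  have nonadj: "\<not> adjacent \<Gamma> x y" if "y \<in> set A" for y
  proof
    assume "adjacent \<Gamma> x y"
    then obtain e where e: "e \<in> edges \<Gamma>" "ends \<Gamma> e = {x, y}" by (auto simp: adjacent_def)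
    have "fst (\<Lambda> e) \<noteq> x" using x e by (auto simp: sink_def)
    then have "\<Lambda> e = (y, x)" using ends_arrow[OF e(1)] arrow_no_loop[OF e(1)] e(2)
      by (metis doubleton_eq_iff prod.collapse)
    moreover have "feasible (mset A)"
      using Cons.prems(3) T by (auto simp: admissible_append intro: admissible_imp_feasible)
    ultimately have "count (mset A) y \<le> count (mset A) x" using feasibleD(1)[OF _ e(1)] by force
    moreover have "count (mset A) x = 0" using A by (simp add: count_eq_zero_iff)
    ultimately show False using that by (simp add: count_eq_zero_iff)
  qed
  have front: "seq_equiv \<Gamma> \<Lambda> T (x # A @ B)"
    using move_sink_to_front[of \<Lambda> A x B] Cons.prems x A nonadj T by blast
  then have "admissible \<Gamma> (reflect \<Gamma> x \<Lambda>) (A @ B)" by (simp add: seq_equiv_def)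
  then have "seq_equiv \<Gamma> (reflect \<Gamma> x \<Lambda>) S (A @ B)"
    using Cons.prems S T by (intro Cons.IH) (auto simp: is_orientation_reflect)
  then show ?case using seq_equiv_Cons[OF x] front seq_equiv_trans seq_equiv_sym by metis
qed

lemma (in quiver) seq_equiv_iff:
  "seq_equiv \<Gamma> \<Lambda> S T \<longleftrightarrow> admissible \<Gamma> \<Lambda> S \<and> admissible \<Gamma> \<Lambda> T \<and> mset S = mset T"
  using mset_eq_imp_seq_equiv[OF orientation] seq_equiv_imp_mset_eq[of \<Gamma> \<Lambda> S T]
  unfolding seq_equiv_def by blast

section \<open>Segments of canonical forms are level sets\<close>

lemma nat_eqI_less:
  fixes m n :: nat
  shows "(\<And>i. i < m \<longleftrightarrow> i < n) \<Longrightarrow> m = n"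
  by (metis linorder_neqE_nat less_irrefl)

lemma segment_supp_Cons:
  "segment_supp (R # Rs) 0 = set R" "segment_supp (R # Rs) (Suc i) = segment_supp Rs i"
  by (simp_all add: segment_supp_def)

lemma segment_supp_subset: "segment_supp Rs i \<subseteq> set (concat Rs)"
proof
  fix x
  assume "x \<in> segment_supp Rs i"
  then have "i < length Rs" "x \<in> set (Rs ! i)"
    by (auto simp: segment_supp_def split: if_splits)
  then show "x \<in> set (concat Rs)" unfolding set_concat by (blast intro: nth_mem)
qed

text \<open>The supports of the segments decrease and no vertex is repeated in a segment. Therefore
  a vertex of multiplicity \<open>k\<close> lies in exactly the first \<open>k\<close> segments.\<close>

lemma count_concat_segments:
  assumes "\<forall>i<length Ss. distinct (Ss ! i) \<and> set (Ss ! i) = set (concat (drop i Ss))"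
  shows "x \<in> segment_supp Ss i \<longleftrightarrow> i < count (mset (concat Ss)) x"
  using assms
proof (induction Ss arbitrary: i)
  case Nil
  then show ?case by (simp add: segment_supp_def)
next
  case (Cons R Ss)
  have "\<forall>i<length Ss. distinct (Ss ! i) \<and> set (Ss ! i) = set (concat (drop i Ss))"
    using Cons.prems by force
  note IH = Cons.IH[OF this]
  have R: "distinct R" "set (concat Ss) \<subseteq> set R" using Cons.prems by force+
  show ?case
  proof (cases "x \<in> set R")
    case True
    then have "count (mset (concat (R # Ss))) x = Suc (count (mset (concat Ss)) x)"
      using R(1) by (simp add: distinct_count_atmost_1)
    then show ?thesis
      using True IH by (cases i) (simp_all add: segment_supp_Cons del: mset_concat concat.simps)
  next
    case False
    have "x \<notin> set (concat Ss)" using False R(2) by blast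
    then have zero: "count (mset (concat (R # Ss))) x = 0"
      using False unfolding count_mset_0_iff by simp
    have "x \<notin> segment_supp (R # Ss) i"
      using False \<open>x \<notin> set (concat Ss)\<close> segment_supp_subset[of Ss] by (cases i) (auto simp: segment_supp_Cons)
    then show ?thesis unfolding zero by simp
  qed
qed

text \<open>For the segments of a meet before the empty ones are dropped, which need not form a
  canonical form, it is enough to count the segments that contain a vertex.\<close>

lemma count_concat_distinct_segments:
  assumes "\<forall>R\<in>set Rs. distinct R"
  shows "count (mset (concat Rs)) x = card {i. i < length Rs \<and> x \<in> set (Rs ! i)}"
  using assms
proof (induction Rs rule: rev_induct)
  case Nil
  then show ?case by simp
next
  case (snoc R Rs)
  have "{i. i < length (Rs @ [R]) \<and> x \<in> set ((Rs @ [R]) ! i)} =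
      {i. i < length Rs \<and> x \<in> set (Rs ! i)} \<union> (if x \<in> set R then {length Rs} else {})"
    by (auto simp: nth_append less_Suc_eq)
  then show ?case using snoc by (auto simp: distinct_count_atmost_1)
qed

context quiver
begin

lemma canonical_form_admissible: "canonical_form \<Gamma> \<Lambda> S Ss \<Longrightarrow> admissible \<Gamma> \<Lambda> S"
  by (simp add: canonical_form_def seq_equiv_def)

text \<open>The segments of a canonical form are the level sets of the multiplicities, and intersections
  and unions of level sets are level sets of minima and maxima. This turns the meet and the join
  of sequences into those of multisets.\<close>

lemma canonical_form_segment_supp:
  assumes "canonical_form \<Gamma> \<Lambda> S Ss"
  shows "x \<in> segment_supp Ss i \<longleftrightarrow> i < count (mset S) x"
  using assms count_concat_segments[of Ss x i]
  by (simp add: canonical_form_def seq_equiv_iff)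

lemma canonical_form_length:
  assumes "canonical_form \<Gamma> \<Lambda> S Ss"
  shows "i < length Ss \<longleftrightarrow> (\<exists>x. i < count (mset S) x)"
proof -
  have "Ss ! i \<noteq> []" if "i < length Ss"
    using assms that by (simp add: canonical_form_def)
  then show ?thesis
    unfolding canonical_form_segment_supp[OF assms, symmetric] segment_supp_def
    by (auto simp flip: set_empty)
qed

lemma is_meetD:
  assumes "is_meet \<Gamma> \<Lambda> S T M"
  shows "admissible \<Gamma> \<Lambda> M" and "mset M = mset S \<inter># mset T"
proof -
  obtain Ss Ts Rs where Ss: "canonical_form \<Gamma> \<Lambda> S Ss" and Ts: "canonical_form \<Gamma> \<Lambda> T Ts"
    and len: "length Rs = min (length Ss) (length Ts)"
    and Rs: "\<forall>i<length Rs. set (Rs ! i) = set (Ss ! i) \<inter> set (Ts ! i)"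
    and M: "canonical_form \<Gamma> \<Lambda> M (filter (\<lambda>R. R \<noteq> []) Rs)"
    using assms by (auto simp: is_meet_def)
  show "admissible \<Gamma> \<Lambda> M" using canonical_form_admissible[OF M] .
  have "distinct R" if "R \<in> set Rs" for R
  proof (cases "R = []")
    case False
    then have "R \<in> set (filter (\<lambda>R. R \<noteq> []) Rs)" using that by simp
    then show ?thesis using M unfolding canonical_form_def in_set_conv_nth by blast
  qed simp
  then have count: "count (mset (concat Rs)) x = card {i. i < length Rs \<and> x \<in> set (Rs ! i)}" for x
    by (intro count_concat_distinct_segments) blast
  have concat: "concat (filter (\<lambda>R. R \<noteq> []) Rs) = concat Rs"
    by (induction Rs) auto
  have "mset M = mset (concat Rs)"
    using M unfolding canonical_form_def seq_equiv_iff concat by blast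
  have "count (mset M) x = count (mset S \<inter># mset T) x" for x
  proof -
    have "i < length Rs \<and> x \<in> set (Rs ! i) \<longleftrightarrow> x \<in> segment_supp Ss i \<and> x \<in> segment_supp Ts i" for i
      using Rs len by (auto simp: segment_supp_def)
    then have "i < length Rs \<and> x \<in> set (Rs ! i) \<longleftrightarrow> i < count (mset S \<inter># mset T) x" for i
      unfolding canonical_form_segment_supp[OF Ss] canonical_form_segment_supp[OF Ts] by simp
    then have "{i. i < length Rs \<and> x \<in> set (Rs ! i)} = {..<count (mset S \<inter># mset T) x}"
      unfolding lessThan_def by simp
    then have "count (mset (concat Rs)) x = count (mset S \<inter># mset T) x"
      unfolding count by (simp only: card_lessThan)
    then show ?thesis unfolding \<open>mset M = mset (concat Rs)\<close> .
  qed
  then show "mset M = mset S \<inter># mset T" by (rule multiset_eqI)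
qed

lemma is_joinD:
  assumes "is_join \<Gamma> \<Lambda> S T J"
  shows "admissible \<Gamma> \<Lambda> J" and "mset J = mset S \<union># mset T"
proof -
  obtain Ss Ts Rs where Ss: "canonical_form \<Gamma> \<Lambda> S Ss" and Ts: "canonical_form \<Gamma> \<Lambda> T Ts"
    and len: "length Rs = max (length Ss) (length Ts)"
    and Rs: "\<forall>i<length Rs. set (Rs ! i) = segment_supp Ss i \<union> segment_supp Ts i"
    and J: "canonical_form \<Gamma> \<Lambda> J Rs"
    using assms by (auto simp: is_join_def)
  show "admissible \<Gamma> \<Lambda> J" using canonical_form_admissible[OF J] .
  have "segment_supp Rs i = segment_supp Ss i \<union> segment_supp Ts i" for i
    using Rs len by (auto simp: segment_supp_def)
  then have "i < count (mset J) x \<longleftrightarrow> i < count (mset S \<union># mset T) x" for i x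
    using canonical_form_segment_supp[OF J, of x i] canonical_form_segment_supp[OF Ss, of x i]
      canonical_form_segment_supp[OF Ts, of x i] by (simp add: less_max_iff_disj)
  then show "mset J = mset S \<union># mset T"
    by (intro multiset_eqI nat_eqI_less)
qed

end

section \<open>Existence of sequences with prescribed multiplicities\<close>

locale acyclic_quiver = quiver +
  assumes acyclic: "no_oriented_cycles \<Gamma> \<Lambda>"
begin

text \<open>Among the vertices that occur less often in \<^term>\<open>S\<close> than in \<^term>\<open>G\<close>, take those of least
  multiplicity in \<^term>\<open>S\<close>, and among these one from which no arrow leads to another of them; it
  exists because there are no oriented cycles. An arrow starting there after \<^term>\<open>S\<close> would have
  its other end lagging behind \<^term>\<open>G\<close> as well, at the same level against the second choice or
  at a lower level against the first.\<close>

lemma one_step_extension: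
  assumes S: "admissible \<Gamma> \<Lambda> S" and G: "feasible G" and sub: "mset S \<subset># G"
  shows "\<exists>x. admissible \<Gamma> \<Lambda> (S @ [x]) \<and> add_mset x (mset S) \<subseteq># G"
proof -
  define f where "f = count (mset S)"
  define D where "D = {x. f x < count G x}"
  have le: "f y \<le> count G y" for y
    using sub by (simp add: f_def mset_subset_eq_count subset_mset.less_imp_le)
  have "\<exists>x. x \<in> D"
    using sub le by (metis D_def f_def le_neq_implies_less mem_Collect_eq multiset_eqI
        subset_mset.less_irrefl)
  then obtain x0 where x0: "x0 \<in> D" "\<forall>y\<in>D. f x0 \<le> f y"
    using ex_has_least_nat[of "\<lambda>x. x \<in> D" _ f] by blast
  define L where "L = {x \<in> D. f x = f x0}"
  have "wf ((\<Lambda> ` edges \<Gamma>)\<inverse>)"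
    using acyclic finite_edges by (simp add: no_oriented_cycles_def finite_acyclic_wf_converse)
  moreover have "x0 \<in> L" using x0 by (simp add: L_def)
  ultimately obtain x where x: "x \<in> L" and terminal: "\<And>y. (x, y) \<in> \<Lambda> ` edges \<Gamma> \<Longrightarrow> y \<notin> L"
    by (metis converse_iff wfE_min)
  have fx: "f x < count G x" "\<And>y. f y < count G y \<Longrightarrow> f x \<le> f y"
    using x x0 by (auto simp: L_def D_def)
  have "fst (reflect_seq \<Gamma> S \<Lambda> e) \<noteq> x" if e: "e \<in> edges \<Gamma>" for e
  proof
    assume start: "fst (reflect_seq \<Gamma> S \<Lambda> e) = x"
    note state = arrow_state[OF e S, folded f_def]
    note G_arrow = feasibleD[OF G e]
    consider "fst (\<Lambda> e) = x" "f (snd (\<Lambda> e)) = f x"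
      | "snd (\<Lambda> e) = x" "f x = Suc (f (fst (\<Lambda> e)))"
      using state
    proof (elim disjE conjE)
      assume "f (snd (\<Lambda> e)) = f (fst (\<Lambda> e))" "reflect_seq \<Gamma> S \<Lambda> e = \<Lambda> e"
      then show ?thesis using start that(1) by simp
    next
      assume "f (snd (\<Lambda> e)) = Suc (f (fst (\<Lambda> e)))" "reflect_seq \<Gamma> S \<Lambda> e = prod.swap (\<Lambda> e)"
      then show ?thesis using start that(2) by simp
    qed
    then show False
    proof cases
      case 1
      then have "snd (\<Lambda> e) \<in> L"
        using x fx(1) G_arrow(1) by (simp add: L_def D_def)
      moreover have "(x, snd (\<Lambda> e)) \<in> \<Lambda> ` edges \<Gamma>"
        using 1(1) e by (metis image_eqI prod.collapse)
      ultimately show False using terminal by blast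
    next
      case 2
      then have "f (fst (\<Lambda> e)) < count G (fst (\<Lambda> e))"
        using fx(1) G_arrow(2) by simp
      then show False using fx(2)[of "fst (\<Lambda> e)"] 2(2) by simp
    qed
  qed
  moreover have "x \<in> verts \<Gamma>"
    using fx(1) G by (metis feasible_def gr_zeroI not_in_iff not_less_zero subset_iff)
  ultimately have "admissible \<Gamma> \<Lambda> (S @ [x])"
    using S by (simp add: admissible_append sink_def)
  moreover have "add_mset x (mset S) \<subseteq># G"
    using fx(1) le by (auto simp: subseteq_mset_def f_def Suc_le_eq)
  ultimately show ?thesis by blast
qed

lemma feasible_extension:
  assumes "admissible \<Gamma> \<Lambda> S" and "feasible G" and "mset S \<subseteq># G"
  shows "\<exists>U. admissible \<Gamma> \<Lambda> (S @ U) \<and> mset S + mset U = G"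
  using assms(1,3)
proof (induction "size G - size S" arbitrary: S rule: less_induct)
  case less
  show ?case
  proof (cases "mset S = G")
    case True
    then show ?thesis using less.prems by (intro exI[of _ "[]"]) simp
  next
    case False
    then have sub: "mset S \<subset># G" using less.prems by auto
    then obtain x where x: "admissible \<Gamma> \<Lambda> (S @ [x])" "mset (S @ [x]) \<subseteq># G"
      using one_step_extension[OF less.prems(1) assms(2)] by auto
    have "size G - size (S @ [x]) < size G - size S"
      using mset_subset_size[OF sub] by simp
    from less.hyps[OF this x] obtain U
      where "admissible \<Gamma> \<Lambda> (S @ x # U)" "mset S + mset (x # U) = G" by auto
    then show ?thesis by blast
  qed
qed

lemma feasible_imp_admissible: "feasible G \<Longrightarrow> \<exists>S. admissible \<Gamma> \<Lambda> S \<and> mset S = G"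
  using feasible_extension[of "[]" G] by simp

text \<open>The segments are built one level at a time, each being an extension from \<^term>\<open>G\<close> truncated
  at height \<^term>\<open>n\<close> to \<^term>\<open>G\<close> truncated at height \<^term>\<open>Suc n\<close>. The truncations are feasible as
  intersections of \<^term>\<open>G\<close> with constant multisets. The number of segments is left open, so that
  trailing segments may be empty.\<close>

lemma segments_exist:
  assumes G: "feasible G"
  shows "\<exists>Rs. length Rs = n \<and> admissible \<Gamma> \<Lambda> (concat Rs) \<and>
    mset (concat Rs) = G \<inter># repeat_mset n (mset_set (verts \<Gamma>)) \<and>
    (\<forall>i<n. distinct (Rs ! i) \<and> set (Rs ! i) = {x. i < count G x})"
proof (induction n)
  case 0
  then show ?case by simp
next
  case (Suc n)
  define trunc where "trunc k = G \<inter># repeat_mset k (mset_set (verts \<Gamma>))" for k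
  have outside: "count G x = 0" if "x \<notin> verts \<Gamma>" for x
    using G that by (auto simp: feasible_def count_eq_zero_iff)
  have count_trunc: "count (trunc k) x = min (count G x) k" for k x
    using outside[of x] by (auto simp: trunc_def finite_verts count_mset_set')
  obtain Rs where Rs: "length Rs = n" "admissible \<Gamma> \<Lambda> (concat Rs)" "mset (concat Rs) = trunc n"
    "\<forall>i<n. distinct (Rs ! i) \<and> set (Rs ! i) = {x. i < count G x}"
    using Suc.IH unfolding trunc_def by blast
  have "feasible (trunc (Suc n))"
    unfolding trunc_def using G feasible_constant by (rule feasible_inter)
  moreover have "mset (concat Rs) \<subseteq># trunc (Suc n)"
    unfolding Rs(3) by (auto simp: subseteq_mset_def count_trunc)
  ultimately obtain R where R: "admissible \<Gamma> \<Lambda> (concat Rs @ R)"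
      "trunc n + mset R = trunc (Suc n)"
    using feasible_extension Rs(2,3) by metis
  have count_R: "count (mset R) x = (if n < count G x then 1 else 0)" for x
    using arg_cong[OF R(2), of "\<lambda>M. count M x"] by (simp add: count_trunc min_def split: if_splits)
  have "x \<in> set R \<longleftrightarrow> n < count G x" for x
    using count_R[of x] count_greater_zero_iff[of "mset R" x] by (simp split: if_splits)
  then have set_R: "set R = {x. n < count G x}" by blast
  have "distinct R"
    by (auto simp: distinct_count_atmost_1 count_R set_R)
  then show ?case
    using Rs R set_R
    by (intro exI[of _ "Rs @ [R]"]) (auto simp: nth_append less_Suc_eq trunc_def)
qed

lemma canonical_form_exists:
  assumes S: "admissible \<Gamma> \<Lambda> S"
  shows "\<exists>Rs. canonical_form \<Gamma> \<Lambda> S Rs"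
proof -
  \<comment> \<open>The number of segments is the greatest multiplicity, so that no segment is empty.\<close>
  define n where "n = (LEAST n. \<forall>x. count (mset S) x \<le> n)"
  have "\<forall>x. count (mset S) x \<le> length S"
    by (metis count_le_size size_mset)
  then have bound: "\<forall>x. count (mset S) x \<le> n"
    unfolding n_def by (rule LeastI)
  have attained: "\<exists>x. i < count (mset S) x" if "i < n" for i
    using not_less_Least[of i "\<lambda>n. \<forall>x. count (mset S) x \<le> n"] that
    unfolding n_def by (metis linorder_not_less)
  obtain Rs where Rs: "length Rs = n" "admissible \<Gamma> \<Lambda> (concat Rs)"
    "mset (concat Rs) = mset S \<inter># repeat_mset n (mset_set (verts \<Gamma>))"
    "\<forall>i<n. distinct (Rs ! i) \<and> set (Rs ! i) = {x. i < count (mset S) x}"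
    using segments_exist[OF admissible_imp_feasible[OF S]] by blast
  have "mset (concat Rs) = mset S"
    unfolding Rs(3) using admissible_imp_verts[OF S] bound
    by (intro multiset_eqI) (auto simp: finite_verts count_mset_set' count_mset_0_iff min_def simp del: count_mset_set)
  then have "seq_equiv \<Gamma> \<Lambda> S (concat Rs)" using S Rs(2) by (simp add: seq_equiv_iff)
  moreover have "set (concat (drop i Rs)) = set (Rs ! i)" if "i < n" for i
  proof
    show "set (Rs ! i) \<subseteq> set (concat (drop i Rs))"
      using that Rs(1) by (auto simp: Cons_nth_drop_Suc[symmetric])
    show "set (concat (drop i Rs)) \<subseteq> set (Rs ! i)"
    proof
      fix x
      assume "x \<in> set (concat (drop i Rs))"
      then obtain j where "i + j < n" "x \<in> set (Rs ! (i + j))"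
        using Rs(1) that by (auto simp: in_set_conv_nth[of _ "drop i Rs"] less_diff_conv add.commute)
      then show "x \<in> set (Rs ! i)" using Rs(4) that by simp
    qed
  qed
  moreover have "Rs ! i \<noteq> []" if "i < n" for i
    using attained[OF that] Rs(4) that by fastforce
  ultimately have "canonical_form \<Gamma> \<Lambda> S Rs"
    using Rs(1,4) by (simp add: canonical_form_def)
  then show ?thesis ..
qed

lemma is_meet_exists:
  assumes S: "admissible \<Gamma> \<Lambda> S" and T: "admissible \<Gamma> \<Lambda> T"
  shows "\<exists>M. is_meet \<Gamma> \<Lambda> S T M"
proof -
  obtain M where M: "admissible \<Gamma> \<Lambda> M" "mset M = mset S \<inter># mset T"
    using feasible_imp_admissible feasible_inter admissible_imp_feasible S T by metis
  obtain Ss Ts Rs where Ss: "canonical_form \<Gamma> \<Lambda> S Ss" and Ts: "canonical_form \<Gamma> \<Lambda> T Ts"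
    and Rs: "canonical_form \<Gamma> \<Lambda> M Rs"
    using canonical_form_exists S T M(1) by metis
  define k where "k = min (length Ss) (length Ts)"
  have supp: "x \<in> segment_supp Rs i \<longleftrightarrow> x \<in> segment_supp Ss i \<and> x \<in> segment_supp Ts i" for x i
    using canonical_form_segment_supp Ss Ts Rs M(2) by simp
  have "i < length Ss \<and> i < length Ts" if "i < length Rs" for i
    using that M(2) unfolding canonical_form_length[OF Ss] canonical_form_length[OF Ts]
      canonical_form_length[OF Rs] by auto
  then have "length Rs \<le> k" unfolding k_def by (meson linorder_not_less min.bounded_iff order_refl)
  \<comment> \<open>Padding with empty segments reaches the prescribed length; the definition of the meet drops them.\<close>
  define Rs' where "Rs' = Rs @ replicate (k - length Rs) []"
  have "length Rs' = k" using \<open>length Rs \<le> k\<close> by (simp add: Rs'_def)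
  moreover have "set (Rs' ! i) = set (Ss ! i) \<inter> set (Ts ! i)" if "i < length Rs'" for i
  proof -
    have "set (Rs' ! i) = segment_supp Rs i"
      using that by (auto simp: Rs'_def segment_supp_def nth_append)
    moreover have "i < length Ss" "i < length Ts"
      using that \<open>length Rs' = k\<close> by (auto simp: k_def)
    ultimately show ?thesis using supp[of _ i] by (auto simp: segment_supp_def)
  qed
  moreover have "filter (\<lambda>R. R \<noteq> []) Rs' = Rs"
    using Rs by (auto simp: Rs'_def canonical_form_def in_set_conv_nth filter_id_conv)
  ultimately show ?thesis
    using Ss Ts Rs unfolding is_meet_def k_def by metis
qed

lemma is_join_exists:
  assumes S: "admissible \<Gamma> \<Lambda> S" and T: "admissible \<Gamma> \<Lambda> T"
  shows "\<exists>J. is_join \<Gamma> \<Lambda> S T J"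
proof -
  obtain J where J: "admissible \<Gamma> \<Lambda> J" "mset J = mset S \<union># mset T"
    using feasible_imp_admissible feasible_union admissible_imp_feasible S T by metis
  obtain Ss Ts Rs where Ss: "canonical_form \<Gamma> \<Lambda> S Ss" and Ts: "canonical_form \<Gamma> \<Lambda> T Ts"
    and Rs: "canonical_form \<Gamma> \<Lambda> J Rs"
    using canonical_form_exists S T J(1) by metis
  have "i < length Rs \<longleftrightarrow> i < length Ss \<or> i < length Ts" for i
    using J(2) unfolding canonical_form_length[OF Ss] canonical_form_length[OF Ts]
      canonical_form_length[OF Rs] by (auto simp: less_max_iff_disj)
  then have "length Rs = max (length Ss) (length Ts)"
    by (intro nat_eqI_less) (simp add: less_max_iff_disj)
  moreover have "set (Rs ! i) = segment_supp Ss i \<union> segment_supp Ts i" if "i < length Rs" for i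
  proof -
    have "set (Rs ! i) = segment_supp Rs i" using that by (simp add: segment_supp_def)
    then show ?thesis
      using canonical_form_segment_supp Ss Ts Rs J(2) by (auto simp: less_max_iff_disj)
  qed
  ultimately show ?thesis
    using Ss Ts Rs unfolding is_join_def by blast
qed

lemma seq_meet:
  assumes "admissible \<Gamma> \<Lambda> S" and "admissible \<Gamma> \<Lambda> T"
  shows "admissible \<Gamma> \<Lambda> (seq_meet \<Gamma> \<Lambda> S T)"
    and "mset (seq_meet \<Gamma> \<Lambda> S T) = mset S \<inter># mset T"
proof -
  have "is_meet \<Gamma> \<Lambda> S T (seq_meet \<Gamma> \<Lambda> S T)"
    unfolding seq_meet_def using is_meet_exists[OF assms] by (rule someI_ex)
  then show "admissible \<Gamma> \<Lambda> (seq_meet \<Gamma> \<Lambda> S T)"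
    "mset (seq_meet \<Gamma> \<Lambda> S T) = mset S \<inter># mset T"
    by (rule is_meetD)+
qed

lemma seq_join:
  assumes "admissible \<Gamma> \<Lambda> S" and "admissible \<Gamma> \<Lambda> T"
  shows "admissible \<Gamma> \<Lambda> (seq_join \<Gamma> \<Lambda> S T)"
    and "mset (seq_join \<Gamma> \<Lambda> S T) = mset S \<union># mset T"
proof -
  have "is_join \<Gamma> \<Lambda> S T (seq_join \<Gamma> \<Lambda> S T)"
    unfolding seq_join_def using is_join_exists[OF assms] by (rule someI_ex)
  then show "admissible \<Gamma> \<Lambda> (seq_join \<Gamma> \<Lambda> S T)"
    "mset (seq_join \<Gamma> \<Lambda> S T) = mset S \<union># mset T"
    by (rule is_joinD)+
qed

end

section \<open>The decomposition theorem\<close>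

theorem theorem2p7:
  fixes \<Gamma> :: "('v, 'e) multigraph" and \<Lambda> :: "('v, 'e) orientation" and S T :: "'v list"
  assumes "connected_multigraph \<Gamma>"
    and "is_orientation \<Gamma> \<Lambda>" and "no_oriented_cycles \<Gamma> \<Lambda>"
    and "admissible \<Gamma> \<Lambda> S" and "admissible \<Gamma> \<Lambda> T"
    and "S \<noteq> []" and "T \<noteq> []"
  shows "let M = seq_meet \<Gamma> \<Lambda> S T; \<Lambda>M = reflect_seq \<Gamma> M \<Lambda> in
    \<exists>U V.
      (admissible \<Gamma> \<Lambda>M U \<and> admissible \<Gamma> \<Lambda>M V \<and>
       seq_equiv \<Gamma> \<Lambda> S (M @ U) \<and> seq_equiv \<Gamma> \<Lambda> T (M @ V) \<and>
       (\<forall>U'. admissible \<Gamma> \<Lambda>M U' \<and> seq_equiv \<Gamma> \<Lambda> S (M @ U') \<longrightarrow> seq_equiv \<Gamma> \<Lambda>M U' U) \<and>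
       (\<forall>V'. admissible \<Gamma> \<Lambda>M V' \<and> seq_equiv \<Gamma> \<Lambda> T (M @ V') \<longrightarrow> seq_equiv \<Gamma> \<Lambda>M V' V)) \<and>
      set U \<inter> set V = {} \<and>
      (admissible \<Gamma> \<Lambda>M (U @ V) \<and> admissible \<Gamma> \<Lambda>M (V @ U) \<and>
       seq_equiv \<Gamma> \<Lambda>M (U @ V) (V @ U)) \<and>
      (seq_equiv \<Gamma> \<Lambda> (seq_join \<Gamma> \<Lambda> S T) (M @ U @ V) \<and>
       seq_equiv \<Gamma> \<Lambda> (M @ U @ V) (S @ V) \<and>
       seq_equiv \<Gamma> \<Lambda> (S @ V) (T @ U))"
proof -
  interpret acyclic_quiver \<Gamma> \<Lambda>
    using assms(1-3)
    by (simp add: acyclic_quiver_def acyclic_quiver_axioms_def quiver_def quiver_axioms_def)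
  define M where "M = seq_meet \<Gamma> \<Lambda> S T"
  define J where "J = seq_join \<Gamma> \<Lambda> S T"
  define \<Lambda>M where "\<Lambda>M = reflect_seq \<Gamma> M \<Lambda>"
  interpret M: quiver \<Gamma> \<Lambda>M unfolding \<Lambda>M_def by (rule quiver_reflect_seq)
  have S: "admissible \<Gamma> \<Lambda> S" and T: "admissible \<Gamma> \<Lambda> T" by fact+
  have M: "admissible \<Gamma> \<Lambda> M" "mset M = mset S \<inter># mset T"
    and J: "admissible \<Gamma> \<Lambda> J" "mset J = mset S \<union># mset T"
    unfolding M_def J_def using seq_meet[OF S T] seq_join[OF S T] by auto
  have adm_M: "admissible \<Gamma> \<Lambda> (M @ W) \<longleftrightarrow> admissible \<Gamma> \<Lambda>M W" for W
    by (simp add: admissible_append M(1) \<Lambda>M_def)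
  obtain U where U: "admissible \<Gamma> \<Lambda> (M @ U)" "mset M + mset U = mset S"
    using feasible_extension[OF M(1) admissible_imp_feasible[OF S]] M(2) by auto
  obtain V where V: "admissible \<Gamma> \<Lambda> (M @ V)" "mset M + mset V = mset T"
    using feasible_extension[OF M(1) admissible_imp_feasible[OF T]] M(2) by auto
  have disj: "set U \<inter> set V = {}"
  proof -
    have "count (mset U) x = 0 \<or> count (mset V) x = 0" for x
      using arg_cong[OF U(2), of "\<lambda>X. count X x"] arg_cong[OF V(2), of "\<lambda>X. count X x"] M(2)
      by (auto simp: min_def split: if_splits)
    then show ?thesis by (auto simp: count_eq_zero_iff)
  qed
  have UV: "admissible \<Gamma> \<Lambda> (M @ U @ V)" and VU: "admissible \<Gamma> \<Lambda> (M @ V @ U)"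
    using admissible_disjoint_extensions U(1) V(1) disj by blast+
  have SV: "admissible \<Gamma> \<Lambda> (S @ V)"
    using admissible_prefix_cong[of S "M @ U" V] S U(2) UV by simp
  have TU: "admissible \<Gamma> \<Lambda> (T @ U)"
    using admissible_prefix_cong[of T "M @ V" U] T V(2) VU by simp
  have join: "mset J = mset M + mset U + mset V"
  proof (rule multiset_eqI)
    fix x
    show "count (mset J) x = count (mset M + mset U + mset V) x"
      using arg_cong[OF U(2), of "\<lambda>X. count X x"] arg_cong[OF V(2), of "\<lambda>X. count X x"] M(2) J(2)
      by (auto simp: min_def max_def split: if_splits)
  qed
  have "admissible \<Gamma> \<Lambda>M U \<and> admissible \<Gamma> \<Lambda>M V \<and>
       seq_equiv \<Gamma> \<Lambda> S (M @ U) \<and> seq_equiv \<Gamma> \<Lambda> T (M @ V) \<and>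
       (\<forall>U'. admissible \<Gamma> \<Lambda>M U' \<and> seq_equiv \<Gamma> \<Lambda> S (M @ U') \<longrightarrow> seq_equiv \<Gamma> \<Lambda>M U' U) \<and>
       (\<forall>V'. admissible \<Gamma> \<Lambda>M V' \<and> seq_equiv \<Gamma> \<Lambda> T (M @ V') \<longrightarrow> seq_equiv \<Gamma> \<Lambda>M V' V)"
    using S T U V
    by (auto simp: seq_equiv_iff M.seq_equiv_iff adm_M simp flip: U(2) V(2))
  moreover have "admissible \<Gamma> \<Lambda>M (U @ V) \<and> admissible \<Gamma> \<Lambda>M (V @ U) \<and>
       seq_equiv \<Gamma> \<Lambda>M (U @ V) (V @ U)"
    using UV VU by (simp add: M.seq_equiv_iff adm_M)
  moreover have "seq_equiv \<Gamma> \<Lambda> J (M @ U @ V) \<and> seq_equiv \<Gamma> \<Lambda> (M @ U @ V) (S @ V) \<and>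
       seq_equiv \<Gamma> \<Lambda> (S @ V) (T @ U)"
    using J(1) UV SV TU join by (simp add: seq_equiv_iff ac_simps flip: U(2) V(2))
  ultimately show ?thesis
    using disj unfolding Let_def M_def[symmetric] J_def[symmetric] \<Lambda>M_def[symmetric] by blast
qed

end
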